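(* Let $q=2^s$ with $s\ge 2$ and let $m$ be odd. Let $n=q^m-1$ and let $\beta$ be a primitive $n$-th root of unity in $\mathbb{F}_{q^m}$. Put $\delta=q^{\frac{m+1}{2}}-2q+1$ and assume $\delta\ge 2$. Let $g(x)$ be the generator polynomial of the BCH code $\mathcal{C}_{(q,n,\delta,1,\beta)}$, let $h(x)=(x^n-1)/g(x)$, let $g^\perp(x)=x^{\deg h(x)}h(x^{-1})/h(0)$ be the generator polynomial of $\mathcal{C}_{(q,n,\delta,1,\beta)}^\perp$, and let $\mathbf{T}_{g^\perp}=\{i\in\{0,1,\dots,n-1\}:g^\perp(\beta^i)=0\}$ be its defining set. Then (i) if $m\ge5$, $\{0,1,\dots,q^{\frac{m+1}{2}}-q\}\cup\{q^{\frac{m+1}{2}},q^{\frac{m+1}{2}}+1,\dots,2q^{\frac{m+1}{2}}-q\}\subseteq \mathbf{T}_{g^\perp}$; (ii) if $m=3$, $\{0,1,\dots,q^2-q+1\}\cup\{q^2,q^2+1,\dots,2q^2-q+1\}\subseteq \mathbf{T}_{g^\perp}$.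
   Context: The Euclidean dual of a linear code $\mathcal{C}\subseteq\mathbb{F}_q^n$ is $\mathcal{C}^\perp=\{c\in\mathbb{F}_q^n:\sum_i c_iy_i=0\ \forall y\in\mathcal{C}\}$. A cyclic code of length $n$ over $\mathbb{F}_q$ is identified with an ideal of $\mathbb{F}_q[x]/\langle x^n-1\rangle$; its generator polynomial is the unique monic divisor of $x^n-1$ generating it. For $\gcd(n,q)=1$ and $\beta$ a primitive $n$-th root of unity, $m_{\beta^i}(x)$ denotes the minimal polynomial of $\beta^i$ over $\mathbb{F}_q$. For integers $\delta\ge2$ and $b$, the BCH code $\mathcal{C}_{(q,n,\delta,b,\beta)}$ is the cyclic code of length $n$ over $\mathbb{F}_q$ with generator polynomial $\mathrm{lcm}\{m_{\beta^b}(x),\dots,m_{\beta^{b+\delta-2}}(x)\}$. *)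

theory Defs
  imports "HOL-Computational_Algebra.Computational_Algebra" "HOL-Library.Cardinality"
begin

text \<open>
  The extension of finite fields is given by two types and a homomorphism from the small field into
  the large one. The sort \<open>field_gcd\<close> makes \<open>Lcm\<close> on polynomials available. It is no restriction:
  every field admits this structure, with normalization, \<open>gcd\<close> and \<open>lcm\<close> uniquely determined, and
  the \<open>Lcm\<close> of a finite set of nonzero polynomials is the monic one.
\<close>

definition field_embedding :: "('k::field \<Rightarrow> 'l::field) \<Rightarrow> bool" where
  "field_embedding \<iota> \<longleftrightarrow>
     \<iota> 1 = 1 \<and> (\<forall>x y. \<iota> (x + y) = \<iota> x + \<iota> y) \<and> (\<forall>x y. \<iota> (x * y) = \<iota> x * \<iota> y)"

definition primitive_root_of_unity :: "nat \<Rightarrow> 'a::field \<Rightarrow> bool" where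
  "primitive_root_of_unity n \<beta> \<longleftrightarrow> n > 0 \<and> \<beta> ^ n = 1 \<and> (\<forall>k. 0 < k \<and> k < n \<longrightarrow> \<beta> ^ k \<noteq> 1)"

definition min_poly :: "('k::field \<Rightarrow> 'l::field) \<Rightarrow> 'l \<Rightarrow> 'k poly" where
  "min_poly \<iota> x = (THE p. lead_coeff p = 1 \<and> poly (map_poly \<iota> p) x = 0 \<and>
     (\<forall>r. r \<noteq> 0 \<and> poly (map_poly \<iota> r) x = 0 \<longrightarrow> degree p \<le> degree r))"

text \<open>
  A word \<open>(c\<^sub>0, \<dots>, c\<^sub>n\<^sub>-\<^sub>1)\<close> is represented by the polynomial with these coefficients, that is, by the
  representative of degree less than \<open>n\<close> of its class modulo \<open>x\<^sup>n - 1\<close>.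
  The following is the ideal of the quotient ring generated by the class of \<open>g\<close>.
\<close>

definition cyclic_ideal :: "nat \<Rightarrow> 'k::field_gcd poly \<Rightarrow> 'k poly set" where
  "cyclic_ideal n g = {(a * g) mod (monom 1 n - 1) | a. True}"

definition is_generator_poly :: "nat \<Rightarrow> 'k::field_gcd poly set \<Rightarrow> 'k poly \<Rightarrow> bool" where
  "is_generator_poly n C g \<longleftrightarrow>
     lead_coeff g = 1 \<and> g dvd (monom 1 n - 1) \<and> C = cyclic_ideal n g"

definition dual_code :: "nat \<Rightarrow> 'k::field poly set \<Rightarrow> 'k poly set" where
  "dual_code n C = {c. (\<forall>i\<ge>n. coeff c i = 0) \<and> (\<forall>y\<in>C. (\<Sum>i<n. coeff c i * coeff y i) = 0)}"

definition bch_code ::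
  "('k::field_gcd \<Rightarrow> 'l::field) \<Rightarrow> nat \<Rightarrow> int \<Rightarrow> int \<Rightarrow> 'l \<Rightarrow> 'k poly set" where
  "bch_code \<iota> n \<delta> b \<beta> =
     cyclic_ideal n (Lcm ((\<lambda>i. min_poly \<iota> (\<beta> powi i)) ` {b..b + \<delta> - 2}))"

definition defining_set :: "('k::field \<Rightarrow> 'l::field) \<Rightarrow> nat \<Rightarrow> 'l \<Rightarrow> 'k poly \<Rightarrow> nat set" where
  "defining_set \<iota> n \<beta> p = {i \<in> {0..<n}. poly (map_poly \<iota> p) (\<beta> ^ i) = 0}"

end

theory Submission
  imports Defs
begin

text \<open>
  The zeros of \<open>g\<^sup>\<bottom>\<close> are the inverses of the zeros of \<open>h\<close>, so \<open>\<beta>\<^sup>i\<close> fails to be a zero only if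
  \<open>\<beta>\<^bsup>-i\<^esup>\<close> is conjugate to some \<open>\<beta>\<^sup>j\<close> with \<open>1 \<le> j < \<delta>\<close>, that is, \<open>i q\<^sup>t + j \<equiv> 0\<close> modulo \<open>n\<close> for some
  \<open>1 \<le> t \<le> m\<close>. With \<open>A = q\<^sup>t\<close> and \<open>B = q\<^bsup>m-t\<^esup>\<close>, splitting \<open>i\<close> as \<open>(U - 1) B + (B - w)\<close> turns the
  congruence into the two equations \<open>i + w = U B\<close> and \<open>j + U = w A\<close> with \<open>1 \<le> U \<le> A\<close> and
  \<open>1 \<le> w \<le> B\<close>. As \<open>A B = q\<^sup>m\<close>, small \<open>i\<close> and \<open>j\<close> are only possible for \<open>t\<close> near \<open>m / 2\<close>, and
  there the bounds on \<open>i\<close> and \<open>j\<close> exclude each other.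
\<close>

subsection \<open>Field embeddings and minimal polynomials\<close>

lemma
  assumes "field_embedding f"
  shows field_embedding_add: "f (x + y) = f x + f y"
    and field_embedding_mult: "f (x * y) = f x * f y"
    and field_embedding_1: "f 1 = 1"
    and field_embedding_0: "f 0 = 0"
    and field_embedding_eq_0_iff: "f x = 0 \<longleftrightarrow> x = 0"
    and field_embedding_minus: "f (- x) = - f x"
proof -
  show add: "f (x + y) = f x + f y" and mult: "f (x * y) = f x * f y" and one: "f 1 = 1" for x y
    using assms by (auto simp: field_embedding_def)
  show zero: "f 0 = 0"
    using add[of 0 0] by (metis add_0 add_right_cancel)
  show "f (- x) = - f x"
    using add[of x "- x"] zero by (simp add: eq_neg_iff_add_eq_0 add.commute)
  show "f x = 0 \<longleftrightarrow> x = 0"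
    using mult[of x "inverse x"] zero one by (cases "x = 0") auto
qed

lemma field_embedding_power: "field_embedding f \<Longrightarrow> f (x ^ k) = f x ^ k"
  by (induction k) (simp_all add: field_embedding_1 field_embedding_mult)

lemma field_embedding_inj: "field_embedding f \<Longrightarrow> inj f"
proof (rule injI)
  fix x y assume f: "field_embedding f" "f x = f y"
  have "f (x + - y) = 0"
    unfolding field_embedding_add[OF f(1)] field_embedding_minus[OF f(1)] using f(2) by simp
  thus "x = y"
    unfolding field_embedding_eq_0_iff[OF f(1)] by simp
qed

lemma field_embedding_sum: "field_embedding f \<Longrightarrow> f (sum g A) = (\<Sum>x\<in>A. f (g x))"
  by (induction A rule: infinite_finite_induct)
     (simp_all add: field_embedding_0 field_embedding_add)

lemma map_poly_mult_embedding:
  assumes "field_embedding f"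
  shows "map_poly f (p * q) = map_poly f p * map_poly f q"
  by (rule poly_eqI)
     (simp add: coeff_map_poly coeff_mult field_embedding_0[OF assms] field_embedding_sum[OF assms]
        field_embedding_mult[OF assms])

lemma map_poly_diff_embedding:
  assumes "field_embedding f"
  shows "map_poly f (p - q) = map_poly f p - map_poly f q"
  by (rule poly_eqI)
     (simp add: coeff_map_poly field_embedding_0[OF assms] field_embedding_minus[OF assms]
        field_embedding_add[OF assms, of _ "- _", simplified])

lemma map_poly_prod_embedding:
  assumes "field_embedding f"
  shows "map_poly f (prod g A) = (\<Prod>x\<in>A. map_poly f (g x))"
  by (induction A rule: infinite_finite_induct)
     (simp_all add: field_embedding_1[OF assms] map_poly_mult_embedding[OF assms])

lemma degree_map_poly_embedding: "field_embedding f \<Longrightarrow> degree (map_poly f p) = degree p"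
  by (rule degree_map_poly) (simp add: field_embedding_eq_0_iff)

lemma map_poly_reflect_embedding:
  assumes "field_embedding f"
  shows "map_poly f (reflect_poly p) = reflect_poly (map_poly f p)"
  by (rule poly_eqI)
     (simp add: coeff_map_poly coeff_reflect_poly field_embedding_0[OF assms]
        degree_map_poly_embedding[OF assms])

lemma root_map_poly_dvd:
  assumes "field_embedding f" "p dvd r" "poly (map_poly f p) x = 0"
  shows "poly (map_poly f r) x = 0"
  using assms by (auto simp: dvd_def map_poly_mult_embedding)

section \<open>Finite fields and the Frobenius map\<close>

lemma field_embedding_frobenius:
  "field_embedding (\<lambda>x::'l::{field,finite}. x ^ (CHAR('l) ^ s))"
  unfolding field_embedding_def
  using prime_CHAR_semidom[where ?'a = 'l] finite_imp_CHAR_pos[where ?'a = 'l]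
  by (simp add: power_mult_distrib freshmans_dream'[where ?'a = 'l])

text \<open>Multiplication by a nonzero \<open>x\<close> permutes the nonzero elements, so it leaves
  their product unchanged; cancelling this nonzero product gives the identity.\<close>

lemma power_card_field_eq_same:
  fixes x :: "'k::{field,finite}"
  shows "x ^ CARD('k) = x"
proof (cases "x = 0")
  case False
  let ?P = "\<Prod>(UNIV - {0::'k})"
  have "(\<Prod>y\<in>UNIV - {0}. x * y) = ?P"
    by (rule prod.reindex_bij_witness[of _ "\<lambda>y. y / x" "(*) x"]) (use False in auto)
  hence "x ^ card (UNIV - {0::'k}) * ?P = 1 * ?P"
    by (simp add: prod.distrib)
  hence "x ^ card (UNIV - {0::'k}) = 1"
    by (subst (asm) mult_cancel_right) simp
  hence "x ^ (CARD('k) - 1) = 1"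
    by (simp add: card_Diff_singleton)
  hence "x ^ Suc (CARD('k) - 1) = x"
    by (simp only: power_Suc mult_1_right)
  moreover have "Suc (CARD('k) - 1) = CARD('k)"
    using zero_less_card_finite[where ?'a = 'k] by simp
  ultimately show ?thesis
    by metis
qed simp

text \<open>Translation by 1 permutes the field, so comparing the sums over all elements shows that
  the cardinality vanishes in the field.\<close>

lemma char_eq_if_card_prime_power:
  assumes "CARD('k::{field,finite}) = p ^ s" "prime p"
  shows "CHAR('k) = p"
proof -
  have "(\<Sum>x\<in>UNIV. x + 1) = (\<Sum>x\<in>UNIV. x :: 'k)"
    by (rule sum.reindex_bij_witness[of _ "\<lambda>x. x - 1" "\<lambda>x. x + 1"]) auto
  hence "of_nat CARD('k) = (0::'k)"
    by (simp add: sum.distrib)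
  hence "CHAR('k) dvd p ^ s"
    unfolding of_nat_eq_0_iff_char_dvd assms(1) .
  moreover have "prime CHAR('k)"
    by (intro prime_CHAR_semidom finite_imp_CHAR_pos) simp
  ultimately show ?thesis
    using assms(2) prime_dvd_power primes_dvd_imp_eq by blast
qed

text \<open>The image has as many elements as the small field, and all of them are roots of
  \<open>x^q - x\<close>, which has at most \<open>q\<close> roots. Membership in the small field
  thus becomes an equation.\<close>

lemma range_field_embedding:
  fixes f :: "'k::{field,finite} \<Rightarrow> 'l::field"
  assumes f: "field_embedding f"
  shows "range f = {x. x ^ CARD('k) = x}"
proof -
  let ?q = "CARD('k)"
  let ?p = "monom 1 ?q - monom 1 1 :: 'l poly"
  have q: "?q > 1"
    using card_mono[of UNIV "{0, 1 :: 'k}"] by simp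
  have "coeff ?p ?q = 1" using q by simp
  hence p: "?p \<noteq> 0" by (metis coeff_0 zero_neq_one)
  have roots: "{x. poly ?p x = 0} = {x. x ^ ?q = x}"
    by (auto simp: poly_monom)
  have "card {x. poly ?p x = 0} \<le> degree ?p"
    using p by (rule card_poly_roots_bound)
  also have "\<dots> \<le> ?q"
    using q by (intro degree_diff_le) (auto intro: order_trans[OF degree_monom_le])
  finally have card: "card {x::'l. x ^ ?q = x} \<le> ?q"
    unfolding roots .
  have "range f \<subseteq> {x. x ^ ?q = x}"
    using field_embedding_power[OF f, of _ ?q] by (auto simp: power_card_field_eq_same)
  moreover have "finite {x::'l. x ^ ?q = x}"
    using poly_roots_finite[OF p] unfolding roots .
  moreover have "card (range f) = ?q"
    using field_embedding_inj[OF f] by (rule card_image)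
  ultimately show ?thesis
    using card by (metis card_seteq)
qed

text \<open>The remainder modulo an annihilator of least degree is an annihilator of smaller degree,
  hence zero. This also makes the monic one unique, so the description in \<open>min_poly\<close>
  denotes; \<open>r\<close> witnesses existence.\<close>

lemma min_poly_dvd:
  assumes f: "field_embedding f" and r: "r \<noteq> 0" "poly (map_poly f r) x = 0"
  shows "min_poly f x dvd r"
proof -
  let ?Q = "\<lambda>p. p \<noteq> 0 \<and> poly (map_poly f p) x = 0"
  let ?M = "\<lambda>p. lead_coeff p = 1 \<and> poly (map_poly f p) x = 0 \<and> (\<forall>r. ?Q r \<longrightarrow> degree p \<le> degree r)"
  have dvd: "p dvd r'" if p: "?M p" and r': "poly (map_poly f r') x = 0" for p r'
  proof (rule ccontr)
    assume ndvd: "\<not> p dvd r'"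
    have "r' mod p = r' - p * (r' div p)"
      by (simp add: minus_mult_div_eq_mod)
    hence "poly (map_poly f (r' mod p)) x = 0"
      using p r' by (simp add: map_poly_diff_embedding[OF f] map_poly_mult_embedding[OF f])
    moreover have "r' mod p \<noteq> 0" using ndvd by (simp add: mod_eq_0_iff_dvd)
    ultimately have "degree p \<le> degree (r' mod p)" using p by blast
    moreover have "p \<noteq> 0" using p by auto
    ultimately show False
      using degree_mod_less_degree[of p r'] ndvd by simp
  qed
  obtain p where p: "?Q p" "\<forall>r. ?Q r \<longrightarrow> degree p \<le> degree r"
    using ex_has_least_nat[of ?Q r degree] r by blast
  have "?M (smult (inverse (lead_coeff p)) p)"
    using p by (auto simp: map_poly_smult field_embedding_0[OF f] field_embedding_mult[OF f])
  moreover have "p1 = p2" if M: "?M p1" "?M p2" for p1 p2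
  proof -
    obtain k where k: "p2 = p1 * k"
      using dvd[OF M(1), of p2] M(2) by blast
    have nz: "p1 \<noteq> 0" "p2 \<noteq> 0" using M by auto
    have "degree p2 \<le> degree p1" using M nz by blast
    hence "degree k = 0" using k nz by (auto simp: degree_mult_eq)
    moreover have "lead_coeff k = 1" using M k by (simp add: lead_coeff_mult)
    ultimately have "k = 1" by (auto elim!: degree_eq_zeroE)
    thus ?thesis using k by simp
  qed
  ultimately have "\<exists>!p. ?M p" by blast
  hence "?M (min_poly f x)"
    unfolding min_poly_def by (rule theI')
  thus ?thesis using dvd r by blast
qed

text \<open>
  The product of the linear factors of all conjugates is fixed by the Frobenius map, so it descends
  to the small field, where the minimal polynomial divides it.
\<close>

lemma root_min_poly_conjugate:
  fixes f :: "'k::{field,finite} \<Rightarrow> 'l::{field,finite}"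
  assumes f: "field_embedding f" and q: "q = CARD('k)" "q = CHAR('l) ^ s"
    and a: "a ^ (q ^ m) = a" and m: "m > 0"
    and c: "poly (map_poly f (min_poly f a)) c = 0"
  obtains l where "l < m" "c = a ^ (q ^ l)"
proof -
  define P where "P = (\<Prod>l<m. [:- (a ^ (q ^ l)), 1:])"
  let ?F = "\<lambda>x::'l. x ^ q"
  have F: "field_embedding ?F"
    unfolding q(2) by (rule field_embedding_frobenius)
  have "map_poly ?F P = (\<Prod>l<m. [:- (a ^ (q ^ Suc l)), 1:])"
    unfolding P_def map_poly_prod_embedding[OF F]
    by (intro prod.cong refl)
       (simp add: map_poly_pCons field_embedding_0[OF F] field_embedding_minus[OF F]
          flip: power_mult, simp add: mult.commute)
  \<comment> \<open>The factors are shifted cyclically: the last one becomes the first because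
    \<open>a ^ (q ^ m) = a\<close>.\<close>
  also have "\<dots> = P"
  proof -
    obtain m' where m': "m = Suc m'" using m by (cases m) auto
    have "P = [:- a, 1:] * (\<Prod>l<m'. [:- (a ^ (q ^ Suc l)), 1:])"
      unfolding P_def m' prod.lessThan_Suc_shift by simp
    thus ?thesis using a by (simp add: m' prod.lessThan_Suc mult.commute)
  qed
  finally have fixP: "map_poly ?F P = P" .
  \<comment> \<open>Coefficients fixed by the \<open>q\<close>-th power lie in the image of
    \<open>f\<close>, so \<open>inv f\<close> pulls them back.\<close>
  have "coeff P i \<in> range f" for i
    using arg_cong[OF fixP, of "\<lambda>p. coeff p i"]
    by (simp add: coeff_map_poly field_embedding_0[OF F] range_field_embedding[OF f] q(1))
  hence inv: "f (inv f (coeff P i)) = coeff P i" for i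
    by (rule f_inv_into_f)
  have inv0: "inv f 0 = 0"
    using inv_f_f[OF field_embedding_inj[OF f], of 0] by (simp add: field_embedding_0[OF f])
  define p where "p = map_poly (inv f) P"
  have p: "map_poly f p = P"
    by (rule poly_eqI) (simp add: p_def coeff_map_poly field_embedding_0[OF f] inv0 inv)
  have "P \<noteq> 0" by (simp add: P_def)
  hence "p \<noteq> 0" using p by auto
  moreover have "poly P a = 0"
    unfolding P_def poly_prod using m by (auto intro!: bexI[of _ 0])
  ultimately have "min_poly f a dvd p"
    using f p by (intro min_poly_dvd) auto
  hence "poly P c = 0"
    using root_map_poly_dvd[OF f] c p by metis
  thus thesis
    using that by (auto simp: P_def poly_prod)
qed

subsection \<open>Duals of cyclic codes\<close>

lemma degree_monom_minus_one: "n > 0 \<Longrightarrow> degree (monom 1 n - 1 :: 'a::field poly) = n"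
  using degree_add_eq_left[of "- 1" "monom 1 n :: 'a poly"] by (simp add: degree_monom_eq)

text \<open>Reduction modulo \<open>x^n - 1\<close> preserves divisibility by its divisor
  \<open>g\<close>, and a word of degree below \<open>n\<close> is its own remainder.\<close>

lemma cyclic_ideal_eq:
  assumes n: "n > 0" and g: "g dvd monom 1 n - 1"
  shows "cyclic_ideal n g = {c. (\<forall>i\<ge>n. coeff c i = 0) \<and> g dvd c}"
proof -
  let ?X = "monom 1 n - 1 :: 'a poly"
  have deg: "degree ?X = n"
    using n by (rule degree_monom_minus_one)
  have X: "?X \<noteq> 0" using deg n by auto
  show ?thesis
  proof (intro equalityI subsetI)
    fix c assume "c \<in> cyclic_ideal n g"
    then obtain a where c: "c = (a * g) mod ?X" by (auto simp: cyclic_ideal_def)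
    have "c = 0 \<or> degree c < n"
      using degree_mod_less[OF X, of "a * g"] by (auto simp: c deg)
    hence "\<forall>i\<ge>n. coeff c i = 0" by (auto intro: coeff_eq_0)
    moreover have "g dvd c" using g by (simp add: c dvd_mod)
    ultimately show "c \<in> {c. (\<forall>i\<ge>n. coeff c i = 0) \<and> g dvd c}" by simp
  next
    fix c assume c: "c \<in> {c. (\<forall>i\<ge>n. coeff c i = 0) \<and> g dvd c}"
    then obtain a where a: "c = a * g" by (auto simp: dvd_def mult.commute)
    have "degree c < n" using c n by (intro degree_lessI) auto
    hence "c mod ?X = c" by (simp add: mod_poly_less deg)
    thus "c \<in> cyclic_ideal n g" unfolding cyclic_ideal_def a by (metis (mono_tags, lifting) mem_Collect_eq)
  qed
qed

text \<open>The reversal \<open>x\<^bsup>n-1\<^esup> c(1/x)\<close> of a word of length \<open>n\<close>.\<close>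

definition rev_word :: "nat \<Rightarrow> 'a::field poly \<Rightarrow> 'a poly" where
  "rev_word n c = monom 1 (n - 1 - degree c) * reflect_poly c"

lemma coeff_rev_word:
  assumes "degree c < n"
  shows "coeff (rev_word n c) k = (if k < n then coeff c (n - 1 - k) else 0)"
  using assms
  by (auto simp: rev_word_def coeff_monom_mult coeff_reflect_poly coeff_eq_0 not_less
           intro!: arg_cong[of _ _ "coeff c"])

lemma degree_rev_word: "degree c < n \<Longrightarrow> degree (rev_word n c) < n"
  by (rule degree_lessI) (auto simp: coeff_rev_word)

text \<open>Reversing one word turns the inner product into a convolution, so orthogonality can be
  studied through products of polynomials.\<close>

lemma inner_product_eq_coeff_rev_word_mult:
  assumes "degree c < n"
  shows "(\<Sum>i<n. coeff c i * coeff y i) = coeff (rev_word n c * y) (n - 1)"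
proof -
  have "coeff (rev_word n c * y) (n - 1) = (\<Sum>i\<le>n - 1. coeff c (n - 1 - i) * coeff y (n - 1 - i))"
    unfolding coeff_mult using assms by (intro sum.cong) (auto simp: coeff_rev_word)
  also have "\<dots> = (\<Sum>i<n. coeff c i * coeff y i)"
    using assms by (intro sum.reindex_bij_witness[of _ "\<lambda>i. n - 1 - i" "\<lambda>i. n - 1 - i"]) auto
  finally show ?thesis ..
qed

text \<open>Reflection forgets powers of \<open>x\<close>, hence does not see the padding factor in
  \<open>rev_word\<close>.\<close>

lemma reflect_poly_monom_mult: "reflect_poly (monom 1 k * p) = reflect_poly p"
  for p :: "'a::field poly"
proof -
  have "reflect_poly (monom 1 k :: 'a poly) = 1"
    by (rule poly_eqI) (auto simp: coeff_reflect_poly degree_monom_eq)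
  thus ?thesis by (simp add: reflect_poly_mult)
qed

text \<open>Reflecting twice strips exactly the power of \<open>x\<close> contained in
  \<open>c\<close>.\<close>

lemma reflect_reflect_poly_dvd: "reflect_poly (reflect_poly c) dvd c"
  for c :: "'a::field poly"
proof (cases "c = 0")
  case False
  obtain p where p: "c = [:- 0, 1:] ^ order 0 c * p" "\<not> [:- 0, 1:] dvd p"
    using order_decomp[OF False, of 0] by blast
  have c: "c = monom 1 (order 0 c) * p"
    using p(1) by (simp add: monom_altdef)
  have "coeff p 0 \<noteq> 0"
    using p(2) unfolding poly_eq_0_iff_dvd[symmetric] by (simp add: poly_0_coeff_0)
  hence "reflect_poly (reflect_poly c) = p"
    by (subst c) (simp add: reflect_poly_monom_mult)
  thus ?thesis by (metis c dvd_triv_right)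
qed simp

text \<open>A nonzero constant term makes \<open>h\<close> equal to its double reflection, so
  divisibility passes through reflection in both directions.\<close>

lemma dvd_rev_word_iff:
  assumes "coeff h 0 \<noteq> 0"
  shows "h dvd rev_word n c \<longleftrightarrow> reflect_poly h dvd c"
proof
  assume "h dvd rev_word n c"
  then obtain w where "rev_word n c = h * w" by blast
  hence "reflect_poly (rev_word n c) = reflect_poly h * reflect_poly w"
    by (simp add: reflect_poly_mult)
  hence "reflect_poly h dvd reflect_poly (reflect_poly c)"
    by (simp add: rev_word_def reflect_poly_monom_mult)
  thus "reflect_poly h dvd c"
    using reflect_reflect_poly_dvd dvd_trans by blast
next
  assume "reflect_poly h dvd c"
  then obtain w where "c = reflect_poly h * w" by blast
  hence "reflect_poly c = h * reflect_poly w"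
    using assms by (simp add: reflect_poly_mult)
  thus "h dvd rev_word n c" by (simp add: rev_word_def)
qed

lemma annihilates_ideal_iff:
  fixes g h c :: "'a::field_gcd poly"
  assumes n: "n > 0" and gh: "g * h = monom 1 n - 1" and c: "degree c < n"
  shows "(\<forall>y\<in>cyclic_ideal n g. (\<Sum>i<n. coeff c i * coeff y i) = 0) \<longleftrightarrow> h dvd rev_word n c"
proof -
  let ?X = "monom 1 n - 1 :: 'a poly"
  let ?R = "rev_word n c"
  have deg: "degree ?X = n"
    using n by (rule degree_monom_minus_one)
  have X: "?X \<noteq> 0" using deg n by auto
  hence g0: "g \<noteq> 0" using gh by auto
  have ideal: "cyclic_ideal n g = {c. (\<forall>i\<ge>n. coeff c i = 0) \<and> g dvd c}"
    using gh by (intro cyclic_ideal_eq n) (metis dvd_triv_left)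
  have Rn: "degree ?R < n" using c by (rule degree_rev_word)
  show ?thesis
  proof
    assume "h dvd ?R"
    then obtain w where w: "?R = h * w" by blast
    show "\<forall>y\<in>cyclic_ideal n g. (\<Sum>i<n. coeff c i * coeff y i) = 0"
    proof
      fix y assume "y \<in> cyclic_ideal n g"
      hence y: "\<forall>i\<ge>n. coeff y i = 0" "g dvd y" by (auto simp: ideal)
      then obtain b where b: "y = g * b" by blast
      have yn: "degree y < n" using y(1) n by (intro degree_lessI) auto
      have Ry: "?R * y = ?X * (w * b)" by (simp add: w b gh[symmetric] mult_ac)
      \<comment> \<open>The product \<open>?R * y\<close> has degree at most \<open>2n - 2\<close>,
        so its cofactor modulo \<open>x^n - 1\<close> has degree at most
        \<open>n - 2\<close>.\<close>
      have "coeff (w * b) (n - 1) = 0"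
      proof (cases "w * b = 0")
        case False
        have "n + degree (w * b) = degree (?R * y)"
          unfolding Ry using X False deg by (subst degree_mult_eq) auto
        also have "\<dots> \<le> degree ?R + degree y" by (rule degree_mult_le)
        finally have "degree (w * b) < n - 1" using Rn yn by linarith
        thus ?thesis by (rule coeff_eq_0)
      qed (simp only: coeff_0)
      hence "coeff (?R * y) (n - 1) = 0"
        unfolding Ry using n by (simp add: left_diff_distrib coeff_monom_mult)
      thus "(\<Sum>i<n. coeff c i * coeff y i) = 0"
        by (simp add: inner_product_eq_coeff_rev_word_mult[OF c])
    qed
  next
    assume orth: "\<forall>y\<in>cyclic_ideal n g. (\<Sum>i<n. coeff c i * coeff y i) = 0"
    define P where "P = ?R * g"
    \<comment> \<open>Testing against the shift of \<open>g\<close> by \<open>n - 1 - k\<close>,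
      which still fits into length \<open>n\<close>, reads off the coefficient of \<open>P\<close>
      at \<open>k\<close>.\<close>
    have gap: "coeff P k = 0" if k: "degree g \<le> k" "k < n" for k
    proof -
      let ?y = "monom 1 (n - 1 - k) * g"
      have "degree ?y < n"
        using k g0 by (subst degree_mult_eq) (auto simp: degree_monom_eq)
      hence "?y \<in> cyclic_ideal n g" by (auto simp: ideal coeff_eq_0)
      hence "coeff (?R * ?y) (n - 1) = 0"
        using orth by (simp add: inner_product_eq_coeff_rev_word_mult[OF c])
      moreover have "?R * ?y = monom 1 (n - 1 - k) * P" by (simp add: P_def mult_ac)
      ultimately have "coeff (monom 1 (n - 1 - k) * P) (n - 1) = 0" by (simp only:)
      moreover have "\<not> n - 1 < n - 1 - k" "n - 1 - (n - 1 - k) = k" using k by auto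
      ultimately show ?thesis by (simp only: coeff_monom_mult if_False mult_1)
    qed
    have degP: "degree P < n + degree g"
      using degree_mult_le[of ?R g] Rn by (simp add: P_def)
    \<comment> \<open>Replacing \<open>x^n\<close> by 1 folds \<open>P\<close> to
      \<open>r + u\<close>, which is still a multiple of \<open>g\<close>. The gap and the degree
      bound on \<open>P\<close> leave it only coefficients below \<open>degree g\<close>, so it
      vanishes.\<close>
    define r u where "r = poly_cutoff n P" and "u = poly_shift n P"
    have P: "P = r + monom 1 n * u"
      by (rule poly_eqI) (auto simp: r_def u_def coeff_poly_cutoff coeff_poly_shift coeff_monom_mult)
    have "r + u = ?R * g - ?X * u"
      using P by (simp add: P_def algebra_simps)
    also have "\<dots> = g * (?R - h * u)"
      by (simp add: gh[symmetric] algebra_simps)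
    finally have "g dvd r + u" by simp
    moreover have "coeff (r + u) k = 0" if "k \<ge> degree g" for k
      using gap[of k] that degP
      by (auto simp: r_def u_def coeff_poly_cutoff coeff_poly_shift coeff_eq_0)
    ultimately have ru: "r + u = 0"
      by (metis dvd_imp_degree_le leading_coeff_0_iff)
    have "g * (?R - h * u) = 0"
      using ru \<open>r + u = ?R * g - ?X * u\<close> \<open>?R * g - ?X * u = g * (?R - h * u)\<close> by simp
    hence "?R = h * u" using g0 by simp
    thus "h dvd ?R" by simp
  qed
qed

text \<open>Orthogonality means that \<open>h\<close> divides the reversed word, equivalently that
  the reflected \<open>h\<close> divides the word. Its leading coefficient is \<open>h(0)\<close>,
  which is nonzero because \<open>g * h\<close> has constant term -1; hence the scaling.\<close>

lemma is_generator_poly_dual: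
  fixes g h :: "'k::field_gcd poly"
  assumes n: "n > 0" and g: "is_generator_poly n C g"
    and h: "h = (monom 1 n - 1) div g"
  shows "is_generator_poly n (dual_code n C) (smult (1 / poly h 0) (reflect_poly h))"
proof -
  have gh: "g * h = monom 1 n - 1"
    using g by (simp add: h is_generator_poly_def)
  have C: "C = cyclic_ideal n g" using g by (simp add: is_generator_poly_def)
  have "coeff (g * h) 0 = -1"
    unfolding gh using n by simp
  hence h0: "coeff h 0 \<noteq> 0" by (auto simp: coeff_mult)
  have ph0: "poly h 0 \<noteq> 0" using h0 by (simp add: poly_0_coeff_0)
  let ?p = "smult (1 / poly h 0) (reflect_poly h)"
  have "lead_coeff ?p = 1"
  proof -
    have "lead_coeff (reflect_poly h) = coeff h 0"
      unfolding degree_reflect_poly_eq[OF h0] by (simp add: coeff_reflect_poly)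
    thus ?thesis using ph0 by (simp only: lead_coeff_smult poly_0_coeff_0) simp
  qed
  moreover have dvd: "?p dvd monom 1 n - 1"
  proof -
    have "reflect_poly h dvd reflect_poly (monom 1 n - 1)"
      unfolding gh[symmetric] by (simp add: reflect_poly_mult)
    also have "reflect_poly (monom 1 n - 1) = - (monom 1 n - 1 :: 'k poly)"
    proof -
      have "degree (monom 1 n - 1 :: 'k poly) = n"
        using n by (rule degree_monom_minus_one)
      thus ?thesis
        by (intro poly_eqI) (auto simp: coeff_reflect_poly coeff_1)
    qed
    finally have "reflect_poly h dvd monom 1 n - 1" by (simp only: dvd_minus_iff)
    thus ?thesis using ph0 by (simp add: smult_dvd_iff)
  qed
  moreover have "dual_code n C = cyclic_ideal n ?p"
  proof -
    have "c \<in> dual_code n C \<longleftrightarrow> c \<in> cyclic_ideal n ?p" for c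
    proof (cases "\<forall>i\<ge>n. coeff c i = 0")
      case True
      hence "degree c < n" using n by (intro degree_lessI) auto
      hence "c \<in> dual_code n C \<longleftrightarrow> h dvd rev_word n c"
        using True annihilates_ideal_iff[OF n gh] by (simp add: dual_code_def C)
      thus ?thesis
        using True ph0 by (simp add: dvd_rev_word_iff[OF h0] cyclic_ideal_eq[OF n dvd] smult_dvd_iff)
    qed (auto simp: dual_code_def cyclic_ideal_eq[OF n dvd])
    thus ?thesis by blast
  qed
  ultimately show ?thesis unfolding is_generator_poly_def by blast
qed

subsection \<open>Cyclotomic cosets\<close>

text \<open>Modulo \<open>n\<close> the product \<open>A * B\<close> is 1, so for
  \<open>i = u B + v\<close> the number \<open>i A + j\<close> is congruent to
  \<open>u + v A + j\<close>. The latter lies strictly between 0 and \<open>2n\<close>, hence equals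
  \<open>n\<close>; then \<open>U = u + 1\<close> and \<open>w = B - v\<close>.\<close>

lemma dvd_shift_decompose:
  fixes A B i j n :: nat
  assumes n: "A * B = n + 1" and dvd: "n dvd i * A + j"
    and i: "i \<le> n" and j: "0 < j" "j < n"
  obtains U w where "i + w = U * B" "j + U = w * A" "1 \<le> U" "U \<le> A" "1 \<le> w" "w \<le> B"
proof -
  define u v where "u = i div B" and "v = i mod B"
  have pos: "A > 0" "B > 0"
    using n by (auto intro: Nat.gr0I)
  have iuv: "i = u * B + v"
    by (simp add: u_def v_def)
  have u: "u < A"
    unfolding u_def using i n by (simp add: div_less_iff_less_mult pos)
  have v: "v < B"
    using pos by (simp add: v_def)
  have "i * A + j = u * n + (u + v * A + j)"
  proof -
    have "i * A = u * (A * B) + v * A"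
      by (simp add: iuv algebra_simps)
    thus ?thesis
      by (simp add: n algebra_simps)
  qed
  with dvd have dvd': "n dvd u + v * A + j"
    by (metis dvd_add_right_iff dvd_triv_right)
  have "(v + 1) * A \<le> B * A"
    using v by (intro mult_right_mono) auto
  hence le: "u + v * A \<le> n"
    using u n by (simp add: mult.commute)
  have eq: "u + v * A + j = n"
  proof -
    obtain k where k: "u + v * A + j = n * k"
      using dvd' by blast
    have "n * k < n * 2"
      using le j k by linarith
    hence "k < 2" by simp
    moreover have "k \<noteq> 0"
      using k j by (intro notI) simp
    ultimately have "k = 1" by linarith
    thus ?thesis using k by simp
  qed
  show thesis
  proof (rule that[of "B - v" "u + 1"])
    show "i + (B - v) = (u + 1) * B"
      using v by (simp add: iuv)
    have "(B - v) * A = A * B - v * A"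
      by (simp only: diff_mult_distrib mult.commute[of A B])
    thus "j + (u + 1) = (B - v) * A"
      using n eq by simp
  qed (use u v in auto)
qed

text \<open>Here \<open>M\<close> stands for \<open>(m + 1) / 2\<close>, and the
  \<open>M = 2\<close> alternative carries the ranges for \<open>m = 3\<close>, longer by one. The
  size of \<open>q ^ m\<close> settles all \<open>t\<close> except \<open>M - 1\<close> and
  \<open>M\<close>.\<close>

lemma shifted_sum_not_dvd:
  fixes q x M t m n i j :: nat
  assumes q: "q \<ge> 4" and M: "M \<ge> 2" and m: "m = 2 * M - 1" and n: "n = q ^ m - 1"
    and t: "1 \<le> t" "t \<le> m"
    and j: "1 \<le> j" "j \<le> q ^ M - 2 * q"
    and i: "i \<le> q ^ M - q \<or> (q ^ M \<le> i \<and> i \<le> 2 * q ^ M - q) \<or>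
       (M = 2 \<and> (i \<le> q ^ M - q + 1 \<or> (q ^ M \<le> i \<and> i \<le> 2 * q ^ M - q + 1)))"
  shows "\<not> n dvd i * q ^ t + j"
proof
  assume dvd: "n dvd i * q ^ t + j"
  \<comment> \<open>In terms of \<open>x\<close>, all relevant sizes are monomials:
    \<open>q ^ M = q^2 x\<close> and \<open>q ^ m = q^3 x^2\<close>, which suits linear
    arithmetic.\<close>
  define x where "x = q ^ (M - 2)"
  have x1: "x \<ge> 1" using q by (simp add: x_def)
  have Q: "q ^ M = q * q * x"
  proof -
    have "M = 2 + (M - 2)" using M by simp
    thus ?thesis unfolding x_def by (metis power_add power2_eq_square)
  qed
  have qm: "q ^ m = q * q * q * x * x"
  proof -
    have "m = 3 + (M - 2) + (M - 2)" using m M by simp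
    hence "q ^ m = q ^ (3 + (M - 2) + (M - 2))" by (rule arg_cong)
    thus ?thesis by (simp only: x_def power_add power3_eq_cube)
  qed
  define Q where "Q = q ^ M"
  have Qx: "Q = q * q * x" using Q by (simp add: Q_def)
  have xx: "x \<le> x * x" using x1 by simp
  have q2: "4 * q \<le> q * q" using q by simp
  have qQ: "4 * q \<le> Q"
  proof -
    have "q * q * 1 \<le> q * q * x" using x1 by (intro mult_left_mono) auto
    thus ?thesis using q2 Qx by linarith
  qed
  have i2: "i \<le> 2 * Q - q + 1"
    using i unfolding Q_def[symmetric] by linarith
  have j2: "j \<le> Q - 2 * q" using j Q_def by simp
  have "4 * Q * 1 \<le> q * Q * x"
    using q x1 by (intro mult_mono) auto
  hence qm4: "4 * Q \<le> q ^ m"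
    by (simp add: qm Qx mult_ac)
  define A B where "A = q ^ t" and "B = q ^ (m - t)"
  have AB: "A * B = q ^ m"
    using t by (simp add: A_def B_def flip: power_add)
  have "A * B = n + 1" "i \<le> n" "0 < j" "j < n"
    using AB n qm4 qQ q i2 j2 j by auto
  then obtain U w where Uw: "i + w = U * B" "j + U = w * A" "1 \<le> U" "U \<le> A" "1 \<le> w" "w \<le> B"
    using dvd_shift_decompose[of A B n i j] dvd unfolding A_def by metis
  have Qxx: "Q \<le> q * q * (x * x)" 
    unfolding Qx using xx by (intro mult_left_mono) auto
  have qqq: "4 * (q * q * (x * x)) \<le> q ^ m"
    unfolding qm using q mult_right_mono[of 4 q "q * q * (x * x)"] by (simp add: mult_ac)
  have xQ: "x \<le> Q"
    using q mult_right_mono[of 1 "q * q" x] by (simp add: Qx)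
  consider "t \<ge> M + 1" | "t = M" | "t = M - 1" | "t + 2 \<le> M"
    by linarith
  thus False
  proof cases
    case 1
    \<comment> \<open>Multiplying \<open>A \<le> j + U\<close> by \<open>B\<close> bounds
      \<open>q ^ m\<close> by \<open>Q B + i + w\<close>, which is less than
      \<open>4 q^2 x^2\<close>.\<close>
    have "m - t \<le> M - 2" using 1 m by simp
    hence Bx: "B \<le> x"
      using q unfolding B_def x_def by (intro power_increasing) auto
    have "A \<le> w * A" using Uw by simp
    hence "A \<le> Q + U" using Uw j2 by linarith
    hence "A * B \<le> Q * B + U * B"
      by (metis add_mult_distrib mult_le_mono1)
    moreover have "Q * B \<le> q * q * (x * x)"
      using Bx unfolding Qx by (simp add: mult.assoc)
    ultimately show False
      using Uw AB qqq Qxx i2 qQ xQ Bx q by linarith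
  next
    case 2
    have A: "A = Q" using 2 by (simp add: A_def Q_def)
    have "m - t = 1 + (M - 2)" using 2 m M by simp
    hence B: "B = q * x" by (simp add: B_def x_def)
    \<comment> \<open>Once \<open>w = 1\<close>, the term \<open>2 * q\<close> in the bound on
      \<open>j\<close> forces \<open>U \<ge> 2 q\<close>, which pushes \<open>i + 1\<close> up to
      \<open>2 Q\<close>.\<close>
    have "w * Q < 2 * Q" using Uw[unfolded A] j2 qQ q by linarith
    hence "w = 1" using Uw by simp
    hence "2 * q \<le> U" using Uw[unfolded A \<open>w = 1\<close>] j2 qQ by linarith
    hence "2 * q * B \<le> U * B" by (intro mult_right_mono) auto
    hence "2 * Q \<le> i + 1" using Uw \<open>w = 1\<close> by (simp add: B Qx)
    thus False using i2 qQ q by linarith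
  next
    case 3
    have "t = 1 + (M - 2)" using 3 M by simp
    hence A: "A = q * x" by (simp add: A_def x_def)
    have "m - t = M" using 3 m M by simp
    hence B: "B = Q" by (simp add: B_def Q_def)
    have QA: "Q = q * A" by (simp add: Qx A)
    have "U * Q < 3 * Q + 1" using Uw[unfolded B] i2 qQ q by linarith
    hence "U * Q < 4 * Q" using qQ q by linarith
    hence "U \<le> 3" using qQ q by simp
    moreover have "U \<noteq> 3"
      using Uw[unfolded B] i2 qQ q by (intro notI) simp
    ultimately have U: "U = 1 \<or> U = 2" using Uw by linarith
    have "w * A < q * A" using Uw j2 U QA qQ q by linarith
    hence w: "w + 1 \<le> q" by simp
    have iU: "i + w = Q \<or> i + w = 2 * Q" using Uw U B by auto
    \<comment> \<open>As \<open>1 \<le> w < q\<close>, the number \<open>i\<close> lies less than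
      \<open>q\<close> below \<open>Q\<close> or \<open>2 Q\<close>. The allowed ranges omit these
      places except for the extra endpoints \<open>Q - q + 1\<close> and \<open>2 Q - q + 1\<close>
      when \<open>M = 2\<close>.\<close>
    have "M = 2" "w + 1 = q"
      using i w iU qQ q Uw unfolding Q_def[symmetric] by linarith+
    hence "A = q" "Q = q * q" by (simp_all add: A x_def Q_def power2_eq_square)
    moreover have "(w + 1) * A = q * A" using \<open>w + 1 = q\<close> by simp
    \<comment> \<open>With \<open>U \<le> 2\<close> this makes \<open>j\<close> at least
      \<open>Q - q - 2\<close>, above its bound \<open>Q - 2 q\<close> since
      \<open>q \<ge> 4\<close>.\<close>
    ultimately have "j + U + q = Q" using Uw by simp
    thus False using j2 U qQ q by linarith
  next
    case 4
    have "A \<le> x" unfolding A_def x_def using q 4 by (intro power_increasing) auto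
    have "B \<le> U * B" using Uw by simp
    hence "B \<le> i + w" using Uw by simp
    \<comment> \<open>Replacing \<open>w A\<close> by \<open>j + U\<close> bounds
      \<open>q ^ m\<close> by \<open>2 q^2 x^2 + j + U\<close>, again below
      \<open>4 q^2 x^2\<close>.\<close>
    hence "B * A \<le> i * A + w * A" by (metis add_mult_distrib mult_le_mono1)
    moreover have "i * A \<le> 2 * Q * x"
      using \<open>A \<le> x\<close> i2 qQ q by (intro mult_mono) linarith+
    hence "i * A \<le> 2 * (q * q * (x * x))" by (simp add: Qx mult.assoc)
    ultimately have "q ^ m \<le> 2 * (q * q * (x * x)) + j + U"
      using AB Uw by (simp add: mult.commute)
    moreover have "U \<le> Q" using Uw \<open>A \<le> x\<close> xQ by linarith
    ultimately show False using qqq Qxx j2 qQ q by linarith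
  qed
qed

subsection \<open>Zeros of the dual of the BCH code\<close>

lemma primitive_root_power_eq_1_dvd:
  assumes "primitive_root_of_unity n b" "b ^ k = 1"
  shows "n dvd k"
proof -
  have n: "n > 0" "b ^ n = 1" "\<And>k. 0 < k \<Longrightarrow> k < n \<Longrightarrow> b ^ k \<noteq> 1"
    using assms(1) by (auto simp: primitive_root_of_unity_def)
  have "b ^ k = (b ^ n) ^ (k div n) * b ^ (k mod n)"
    by (simp flip: power_mult power_add)
  hence "b ^ (k mod n) = 1"
    using n(2) assms(2) by simp
  hence "k mod n = 0"
    using n(1) n(3)[of "k mod n"] by (cases "k mod n = 0") auto
  thus ?thesis by blast
qed

text \<open>The inverse of \<open>\<beta> ^ i\<close> is a root of \<open>x^n - 1\<close>, hence of
  \<open>g\<close> or of its cofactor. A root of \<open>g\<close> would be conjugate to some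
  \<open>\<beta> ^ k\<close> with \<open>k\<close> in the designed range, which the assumption on
  \<open>i\<close> forbids.\<close>

lemma bch_check_poly_root:
  fixes f :: "'k::{field_gcd,finite} \<Rightarrow> 'l::{field,finite}"
  assumes f: "field_embedding f" and q: "q = CARD('k)" "q = CHAR('l) ^ s"
    and l: "CARD('l) = q ^ m" and n: "n = q ^ m - 1" and m: "m > 0"
    and b: "primitive_root_of_unity n \<beta>"
    and g: "is_generator_poly n (bch_code f n \<delta> 1 \<beta>) g"
    and i: "\<And>t j. 1 \<le> t \<Longrightarrow> t \<le> m \<Longrightarrow> 1 \<le> j \<Longrightarrow> int j \<le> \<delta> - 1 \<Longrightarrow> \<not> n dvd i * q ^ t + j"
  shows "poly (map_poly f ((monom 1 n - 1) div g)) (inverse (\<beta> ^ i)) = 0"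
proof -
  let ?X = "monom 1 n - 1 :: 'k poly"
  have n0: "n > 0" and bn: "\<beta> ^ n = 1" using b by (auto simp: primitive_root_of_unity_def)
  have b0: "\<beta> \<noteq> 0" using n0 bn by (intro notI) (simp add: power_0_left)
  define c where "c = inverse (\<beta> ^ i)"
  have "(\<beta> ^ i) ^ n = 1" using bn by (metis power_mult mult.commute power_one)
  hence "c ^ n = 1" by (simp add: c_def power_inverse)
  hence "poly (map_poly f ?X) c = 0"
    by (simp add: map_poly_diff_embedding[OF f] map_poly_monom field_embedding_0[OF f]
        field_embedding_1[OF f] poly_monom)
  moreover have gX: "g dvd ?X" using g by (simp add: is_generator_poly_def)
  hence "?X = g * (?X div g)" by simp
  ultimately have "poly (map_poly f g) c * poly (map_poly f (?X div g)) c = 0"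
    using map_poly_mult_embedding[OF f] by (metis poly_mult)
  moreover have "poly (map_poly f g) c \<noteq> 0"
  proof
    assume gc: "poly (map_poly f g) c = 0"
    let ?A = "{1..\<delta> - 1}" and ?p = "\<lambda>j. min_poly f (\<beta> powi j)"
    have A: "{1..1 + \<delta> - 2} = ?A" by simp
    define L where "L = Lcm (?p ` ?A)"
    \<comment> \<open>\<open>g\<close> is tied to \<open>L\<close> only by generating the same
      ideal; the remainder of \<open>L\<close> in that ideal transfers divisibility.\<close>
    have "L mod ?X \<in> cyclic_ideal n L"
      unfolding cyclic_ideal_def by (auto intro!: exI[of _ 1])
    also have "cyclic_ideal n L = cyclic_ideal n g"
      using g unfolding is_generator_poly_def bch_code_def A L_def by simp
    finally have "g dvd L mod ?X"
      by (simp add: cyclic_ideal_eq[OF n0 gX])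
    hence "g dvd L" using gX by (simp add: dvd_mod_iff)
    also have "L dvd (\<Prod>j\<in>?A. ?p j)"
      unfolding L_def by (rule Lcm_least) auto
    finally have "poly (map_poly f (\<Prod>j\<in>?A. ?p j)) c = 0"
      using root_map_poly_dvd[OF f _ gc] by blast
    then obtain j where j: "j \<in> ?A" "poly (map_poly f (?p j)) c = 0"
      by (auto simp: map_poly_prod_embedding[OF f] poly_prod)
    define k where "k = nat j"
    have k: "1 \<le> k" "int k \<le> \<delta> - 1" "?p j = min_poly f (\<beta> ^ k)"
      using j(1) by (auto simp: k_def power_int_def)
    have "(\<beta> ^ k) ^ (q ^ m) = \<beta> ^ k"
      using power_card_field_eq_same[of "\<beta> ^ k"] by (simp add: l)
    then obtain l where lm: "l < m" and cl: "c = (\<beta> ^ k) ^ (q ^ l)"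
      using root_min_poly_conjugate[OF f q _ m] j(2) k(3) by metis
    have "\<beta> ^ (i + k * q ^ l) = \<beta> ^ i * c"
      by (simp add: cl power_add power_mult)
    also have "\<dots> = 1" using b0 by (simp add: c_def)
    finally have "n dvd i + k * q ^ l"
      by (rule primitive_root_power_eq_1_dvd[OF b])
    \<comment> \<open>This factor turns \<open>q ^ l\<close> into \<open>q ^ m\<close>, which is 1
      modulo \<open>n\<close>; the remaining exponent \<open>m - l\<close> lies between 1 and
      \<open>m\<close>.\<close>
    hence "n dvd (i + k * q ^ l) * q ^ (m - l)" by simp
    also have "(i + k * q ^ l) * q ^ (m - l) = i * q ^ (m - l) + k * q ^ m"
      using lm by (simp add: add_mult_distrib mult.assoc flip: power_add)
    also have "q ^ m = n + 1"
      using n0 n by simp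
    also have "i * q ^ (m - l) + k * (n + 1) = k * n + (i * q ^ (m - l) + k)"
      by (simp add: algebra_simps)
    finally have "n dvd i * q ^ (m - l) + k"
      by (metis dvd_add_right_iff dvd_triv_right)
    thus False using i[of "m - l" k] k lm by simp
  qed
  ultimately show ?thesis by (simp add: c_def)
qed

theorem theorem4:
  fixes \<iota> :: "'k::{field_gcd,finite} \<Rightarrow> 'l::{field,finite}"
    and s m q n :: nat and \<delta> :: int and \<beta> :: 'l
    and g h gperp :: "'k poly"
  assumes "s \<ge> 2" and "q = 2 ^ s" and "odd m" and "n = q ^ m - 1"
    and "CARD('k) = q" and "CARD('l) = q ^ m" and "field_embedding \<iota>"
    and "primitive_root_of_unity n \<beta>"
    and "\<delta> = int q ^ ((m + 1) div 2) - 2 * int q + 1" and "\<delta> \<ge> 2"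
    and "is_generator_poly n (bch_code \<iota> n \<delta> 1 \<beta>) g"
    and "h = (monom 1 n - 1) div g"
    and "gperp = smult (1 / poly h 0) (reflect_poly h)"
  shows "is_generator_poly n (dual_code n (bch_code \<iota> n \<delta> 1 \<beta>)) gperp \<and>
    (m \<ge> 5 \<longrightarrow>
      {0..q ^ ((m + 1) div 2) - q} \<union> {q ^ ((m + 1) div 2)..2 * q ^ ((m + 1) div 2) - q}
        \<subseteq> defining_set \<iota> n \<beta> gperp) \<and>
    (m = 3 \<longrightarrow>
      {0..q ^ 2 - q + 1} \<union> {q ^ 2..2 * q ^ 2 - q + 1} \<subseteq> defining_set \<iota> n \<beta> gperp)"
proof -
  have q4: "q \<ge> 4"
    using power_increasing[of 2 s "2::nat"] assms(1,2) by simp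
  define M where "M = (m + 1) div 2"
  have mM: "m = 2 * M - 1" "M \<ge> 1"
    using \<open>odd m\<close> by (auto simp: M_def elim!: oddE)
  \<comment> \<open>For \<open>M = 1\<close> the designed distance would be \<open>1 - q\<close>,
    contradicting \<open>\<delta> \<ge> 2\<close>.\<close>
  have "M \<noteq> 1"
    using assms(9,10) q4 unfolding M_def[symmetric] by (intro notI) simp
  hence M: "M \<ge> 2" "m > 0" using mM by auto
  have n0: "n > 0" using assms(8) by (simp add: primitive_root_of_unity_def)
  have "CHAR('l) = 2"
    using assms(2,6) by (intro char_eq_if_card_prime_power[of _ "s * m"]) (auto simp: power_mult)
  hence q: "q = CARD('k)" "q = CHAR('l) ^ s"
    using assms(2,5) by auto
  have "4 * q \<le> q * q" using q4 by simp
  also have "\<dots> \<le> q ^ M"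
    using power_increasing[of 2 M q] M q4 by (simp add: power2_eq_square)
  finally have qM: "4 * q \<le> q ^ M" .
  have "4 * q ^ M \<le> q * q ^ M" using q4 by simp
  also have "\<dots> = q ^ (M + 1)" by simp
  also have "\<dots> \<le> q ^ m" using M mM q4 by (intro power_increasing) auto
  finally have nM: "4 * q ^ M \<le> n + 1" using assms(4) by simp
  have root: "i \<in> defining_set \<iota> n \<beta> gperp"
    if i: "i \<le> q ^ M - q \<or> (q ^ M \<le> i \<and> i \<le> 2 * q ^ M - q) \<or>
      (M = 2 \<and> (i \<le> q ^ M - q + 1 \<or> (q ^ M \<le> i \<and> i \<le> 2 * q ^ M - q + 1)))" for i
  proof -
    have "i < n" using i nM qM q4 by linarith
    have "\<beta> \<noteq> 0"
      using assms(8) by (intro notI) (auto simp: primitive_root_of_unity_def power_0_left)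
    have "\<not> n dvd i * q ^ t + j" if "1 \<le> t" "t \<le> m" "1 \<le> j" "int j \<le> \<delta> - 1" for t j
    proof (rule shifted_sum_not_dvd[OF q4 M(1) mM(1) assms(4) that(1-3) _ i])
      have "int j \<le> int (q ^ M) - int (2 * q)"
        using that(4) assms(9) by (simp add: M_def)
      thus "j \<le> q ^ M - 2 * q" by linarith
    qed
    hence "poly (map_poly \<iota> h) (inverse (\<beta> ^ i)) = 0"
      unfolding assms(12)
      by (rule bch_check_poly_root[OF assms(7) q assms(6,4) M(2) assms(8,11)])
    \<comment> \<open>At a nonzero point, the reflected polynomial is a power of the point times the
      value of \<open>h\<close> at its inverse.\<close>
    hence "poly (map_poly \<iota> gperp) (\<beta> ^ i) = 0"
      using \<open>\<beta> \<noteq> 0\<close> field_embedding_0[OF assms(7)] field_embedding_mult[OF assms(7)]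
      by (simp add: assms(13) map_poly_smult map_poly_reflect_embedding[OF assms(7)]
          poly_reflect_poly_nz)
    thus ?thesis using \<open>i < n\<close> by (simp add: defining_set_def)
  qed
  have "is_generator_poly n (dual_code n (bch_code \<iota> n \<delta> 1 \<beta>)) gperp"
    unfolding assms(13) using n0 assms(11,12) by (rule is_generator_poly_dual)
  moreover have "{0..q ^ M - q} \<union> {q ^ M..2 * q ^ M - q} \<subseteq> defining_set \<iota> n \<beta> gperp"
    by (intro subsetI root) auto
  moreover have "{0..q ^ 2 - q + 1} \<union> {q ^ 2..2 * q ^ 2 - q + 1} \<subseteq> defining_set \<iota> n \<beta> gperp"
    if "m = 3"
  proof -
    have "M = 2" using that by (simp add: M_def)
    thus ?thesis by (intro subsetI root) auto
  qed
  ultimately show ?thesis unfolding M_def by blast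
qed

end
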